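(* Let $\mu_m$ be a Borel probability measure on $\mathcal{M}$, $\mathcal{Z}_{ad}\subset\mathcal{Z}$ compact, $\mathcal{B}\subset\mathcal{Z}$ open with $\mathcal{Z}_{ad}\subset\mathcal{B}$, and $p\ge2$. Suppose $u:\mathcal{M}\times\mathcal{B}\to\mathcal{U}$ and $u_\theta:\mathcal{M}\times\mathcal{B}\to\mathcal{U}$ both satisfy Assumption A, and $Q:\mathcal{U}\times\mathcal{M}\times\mathcal{B}\to\mathbb{R}$ satisfies Assumption B, with $(\mu_m,\mathcal{Z}_{ad},\mathcal{B},p)$. Let $$\mathcal{J}^{\mathrm{mean}}(z):=\mathbb{E}_{m\sim\mu_m}[Q(u(m,z),m,z)],\qquad \mathcal{J}^{\mathrm{mean}}_\theta(z):=\mathbb{E}_{m\sim\mu_m}[Q(u_\theta(m,z),m,z)].$$ Then there are constants $C_1,C_2$, independent of $u_\theta$, such that for every $z\in\mathcal{Z}_{ad}$ $$\begin{aligned}\|D_z\mathcal{J}^{\mathrm{mean}}(z)-D_z\mathcal{J}^{\mathrm{mean}}_\theta(z)\|_{\mathcal{Z}'}\le{}& C_1\Big(\|u(\cdot,z)-u_\theta(\cdot,z)\|_{L^2_{\mu_m}(\mathcal{M};\mathcal{U})}+\|D_zu(\cdot,z)-D_zu_\theta(\cdot,z)\|_{L^2_{\mu_m}(\mathcal{M};\mathrm{HS}(\mathcal{Z},\mathcal{U}))}\Big)\\&+C_2\Big(\|u(\cdot,z)-u_\theta(\cdot,z)\|^2_{L^2_{\mu_m}(\mathcal{M};\mathc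al{U})}+\|D_zu(\cdot,z)-D_zu_\theta(\cdot,z)\|^2_{L^2_{\mu_m}(\mathcal{M};\mathrm{HS}(\mathcal{Z},\mathcal{U}))}\Big).\end{aligned}$$
   Context: $\mathcal{M}$ and $\mathcal{U}$ are separable real Hilbert spaces and $\mathcal{Z}=\mathbb{R}^{d_z}$ is a finite-dimensional real Hilbert space. A prime denotes the topological dual, $\mathcal{L}(X,Y)$ the bounded linear operators with operator norm, $\mathrm{HS}(X,Y)$ the Hilbert–Schmidt operators with Hilbert–Schmidt norm, $D$ Fréchet derivatives, $D_{uz}Q=D_uD_zQ\in\mathcal{L}(\mathcal{U},\mathcal{Z}')$, and $\|F\|_{L^p_{\mu}(\mathcal{M};Y)}=(\mathbb{E}_{m\sim\mu}\|F(m)\|_Y^p)^{1/p}$ the Bochner norm. Assumption A (on a map $u$, with $(\mu_m,\mathcal{Z}_{ad},\mathcal{B},p)$): $\mu_m$ is a Borel probability measure on $\mathcal{M}$ with finite $p$-th moment $\mathbb{E}_{\mu_m}\|m\|_{\mathcal{M}}^p<\infty$, $\mathcal{Z}_{ad}\subset\mathcal{Z}$ is compact, $\mathcal{B}\supset\mathcal{Z}_{ad}$ is open, and: (1) $u:\mathcal{M}\times\mathcal{B}\to\mathcal{U}$ is continuously (Fréchet) differentiable; (2) there are constants $\kappa_u,\kappa_{u_z}>0$ such that for all $z_1,z_2\in\mathcal{B}$, $m_1,m_2\in\mathcal{M}$: $\|u(m_2,z_2)-u(m_1,z_1)\|_{\mathcal{U}}\le\kappa_u(\|m_2-m_1\|_{\mathcal{M}}+\|z_2-z_1\|_{\mathcal{Z}})$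 and $\|D_zu(m_2,z_2)-D_zu(m_1,z_1)\|_{\mathrm{HS}(\mathcal{Z},\mathcal{U})}\le\kappa_{u_z}(\|m_2-m_1\|_{\mathcal{M}}+\|z_2-z_1\|_{\mathcal{Z}})$. Assumption B (on $Q$, with $\mathcal{Z}_{ad}$ compact and $\mathcal{B}\supset\mathcal{Z}_{ad}$ open): (1) $Q:\mathcal{U}\times\mathcal{M}\times\mathcal{B}\to\mathbb{R}$ is twice continuously differentiable; (2) there are constants $\kappa_{Q_u},\kappa_{Q_{uz}}>0$ such that for all $u_1,u_2\in\mathcal{U}$, $z\in\mathcal{B}$, $m\in\mathcal{M}$: $\|D_uQ(u_2,m,z)-D_uQ(u_1,m,z)\|_{\mathcal{U}'}\le\kappa_{Q_u}\|u_2-u_1\|_{\mathcal{U}}$ and $\|D_{uz}Q(u_2,m,z)-D_{uz}Q(u_1,m,z)\|_{\mathcal{L}(\mathcal{U},\mathcal{Z}')}\le\kappa_{Q_{uz}}\|u_2-u_1\|_{\mathcal{U}}$; (3) there are constants $M_Q,M_{Q_u},M_{Q_z},M_{Q_{uz}}\ge0$ such that for all $z\in\mathcal{B}$, $m\in\mathcal{M}$: $|Q(0,m,z)|\le M_Q$, $\|D_uQ(0,m,z)\|_{\mathcal{U}'}\le M_{Q_u}$, $\|D_zQ(0,m,z)\|_{\mathcal{Z}'}\le M_{Q_z}$, $\|D_{uz}Q(0,m,z)\|_{\mathcal{L}(\mathcal{U},\mathcal{Z}')}\le M_{Q_{uz}}$. *)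

theory Defs
  imports "HOL-Analysis.Analysis" "HOL-Probability.Probability_Measure"
begin

(* Frechet derivative as a bounded linear operator with operator norm.  Meaningful only where f
   is differentiable at x; below it is used on open sets only. *)
definition fderiv :: "('a::real_normed_vector \<Rightarrow> 'b::real_normed_vector) \<Rightarrow> 'a \<Rightarrow> ('a \<Rightarrow>\<^sub>L 'b)" where
  "fderiv f x = Blinfun (frechet_derivative f (at x))"

lemma fderiv_has_derivative:
  assumes "f differentiable (at x)"
  shows "(f has_derivative blinfun_apply (fderiv f x)) (at x)"
  using assms unfolding fderiv_def frechet_derivative_works
  by (simp add: bounded_linear_Blinfun_apply has_derivative_bounded_linear)

lemma fderiv_eqI:
  assumes "(f has_derivative blinfun_apply D) (at x)"
  shows "fderiv f x = D"
  unfolding fderiv_def frechet_derivative_at[OF assms, symmetric] by (rule blinfun_apply_inverse)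

definition C1_on :: "'a::real_normed_vector set \<Rightarrow> ('a \<Rightarrow> 'b::real_normed_vector) \<Rightarrow> bool" where
  "C1_on S f \<longleftrightarrow> (\<forall>x\<in>S. f differentiable (at x)) \<and> continuous_on S (fderiv f)"

definition C2_on :: "'a::real_normed_vector set \<Rightarrow> ('a \<Rightarrow> 'b::real_normed_vector) \<Rightarrow> bool" where
  "C2_on S f \<longleftrightarrow> C1_on S f \<and> C1_on S (fderiv f)"

(* On a finite-dimensional domain every operator is Hilbert-Schmidt, and Basis is an orthonormal
   basis. *)
definition hs_norm :: "('z::euclidean_space \<Rightarrow>\<^sub>L 'u::real_inner) \<Rightarrow> real" where
  "hs_norm T = sqrt (\<Sum>b\<in>Basis. (norm (blinfun_apply T b))\<^sup>2)"

(* Bochner space L^p and its norm; N is the norm of the target space.  It is a parameter because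
   operators 'z \<Rightarrow>\<^sub>L 'u are measured in the Hilbert-Schmidt norm, whereas the type
   carries the operator norm.  (The two norms have the same topology, hence the same Borel sets.) *)
definition in_Lp :: "('b::topological_space \<Rightarrow> real) \<Rightarrow> real \<Rightarrow> 'm measure \<Rightarrow> ('m \<Rightarrow> 'b) \<Rightarrow> bool" where
  "in_Lp N p \<mu> F \<longleftrightarrow> F \<in> borel_measurable \<mu> \<and> integrable \<mu> (\<lambda>m. N (F m) powr p)"

definition Lp_norm :: "('b \<Rightarrow> real) \<Rightarrow> real \<Rightarrow> 'm measure \<Rightarrow> ('m \<Rightarrow> 'b) \<Rightarrow> real" where
  "Lp_norm N p \<mu> F = (\<integral>m. N (F m) powr p \<partial>\<mu>) powr (1 / p)"

definition Dz_state ::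
  "('m \<times> 'z::real_normed_vector \<Rightarrow> 'u::real_normed_vector) \<Rightarrow> 'm \<Rightarrow> 'z \<Rightarrow> ('z \<Rightarrow>\<^sub>L 'u)" where
  "Dz_state u m z = fderiv (\<lambda>z'. u (m, z')) z"

definition Du_Q ::
  "('u::real_normed_vector \<times> 'm \<times> 'z \<Rightarrow> real) \<Rightarrow> 'u \<Rightarrow> 'm \<Rightarrow> 'z \<Rightarrow> ('u \<Rightarrow>\<^sub>L real)" where
  "Du_Q Q w m z = fderiv (\<lambda>w'. Q (w', m, z)) w"

definition Dz_Q ::
  "('u \<times> 'm \<times> 'z::real_normed_vector \<Rightarrow> real) \<Rightarrow> 'u \<Rightarrow> 'm \<Rightarrow> 'z \<Rightarrow> ('z \<Rightarrow>\<^sub>L real)" where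
  "Dz_Q Q w m z = fderiv (\<lambda>z'. Q (w, m, z')) z"

definition Duz_Q ::
  "('u::real_normed_vector \<times> 'm \<times> 'z::real_normed_vector \<Rightarrow> real)
     \<Rightarrow> 'u \<Rightarrow> 'm \<Rightarrow> 'z \<Rightarrow> ('u \<Rightarrow>\<^sub>L ('z \<Rightarrow>\<^sub>L real))" where
  "Duz_Q Q w m z = fderiv (\<lambda>w'. Dz_Q Q w' m z) w"

(* Maps on M x B are total functions on the product type; their values for z outside B
   are irrelevant, since B is open and only derivatives at points of B are used. *)
definition assumption_A ::
  "'m::{real_inner,banach,second_countable_topology} measure \<Rightarrow> 'z::euclidean_space set \<Rightarrow> 'z set \<Rightarrow> real
     \<Rightarrow> ('m \<times> 'z \<Rightarrow> 'u::{real_inner,banach,second_countable_topology}) \<Rightarrow> bool" where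
  "assumption_A \<mu> Zad B p u \<longleftrightarrow>
     prob_space \<mu> \<and> sets \<mu> = sets borel \<and> integrable \<mu> (\<lambda>m. norm m powr p) \<and>
     compact Zad \<and> open B \<and> Zad \<subseteq> B \<and>
     C1_on (UNIV \<times> B) u \<and>
     (\<exists>\<kappa>u \<kappa>uz. \<kappa>u > 0 \<and> \<kappa>uz > 0 \<and>
        (\<forall>z1\<in>B. \<forall>z2\<in>B. \<forall>m1 m2.
           norm (u (m2, z2) - u (m1, z1)) \<le> \<kappa>u * (norm (m2 - m1) + norm (z2 - z1)) \<and>
           hs_norm (Dz_state u m2 z2 - Dz_state u m1 z1) \<le> \<kappa>uz * (norm (m2 - m1) + norm (z2 - z1))))"

definition assumption_B ::
  "'z::euclidean_space set \<Rightarrow> 'z set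
     \<Rightarrow> ('u::{real_inner,banach,second_countable_topology}
          \<times> 'm::{real_inner,banach,second_countable_topology} \<times> 'z \<Rightarrow> real) \<Rightarrow> bool" where
  "assumption_B Zad B Q \<longleftrightarrow>
     compact Zad \<and> open B \<and> Zad \<subseteq> B \<and>
     C2_on (UNIV \<times> UNIV \<times> B) Q \<and>
     (\<exists>\<kappa>Qu \<kappa>Quz. \<kappa>Qu > 0 \<and> \<kappa>Quz > 0 \<and>
        (\<forall>w1 w2 m. \<forall>z\<in>B.
           norm (Du_Q Q w2 m z - Du_Q Q w1 m z) \<le> \<kappa>Qu * norm (w2 - w1) \<and>
           norm (Duz_Q Q w2 m z - Duz_Q Q w1 m z) \<le> \<kappa>Quz * norm (w2 - w1))) \<and>
     (\<exists>MQ MQu MQz MQuz. MQ \<ge> 0 \<and> MQu \<ge> 0 \<and> MQz \<ge> 0 \<and> MQuz \<ge> 0 \<and>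
        (\<forall>m. \<forall>z\<in>B.
           \<bar>Q (0, m, z)\<bar> \<le> MQ \<and> norm (Du_Q Q 0 m z) \<le> MQu \<and>
           norm (Dz_Q Q 0 m z) \<le> MQz \<and> norm (Duz_Q Q 0 m z) \<le> MQuz))"

definition J_mean ::
  "'m measure \<Rightarrow> ('u \<times> 'm \<times> 'z \<Rightarrow> real) \<Rightarrow> ('m \<times> 'z \<Rightarrow> 'u) \<Rightarrow> 'z \<Rightarrow> real" where
  "J_mean \<mu> Q u z = (\<integral>m. Q (u (m, z), m, z) \<partial>\<mu>)"

end

theory Submission
  imports Defs
begin

text \<open>Differentiating under the integral, the gradient of the objective at \<open>z\<close> is the
  mean of \<open>D\<^sub>uQ(u) \<circ> D\<^sub>zu + D\<^sub>zQ(u)\<close>. Since \<open>D\<^sub>uQ\<close> and \<open>D\<^sub>u\<^sub>zQ\<close> are Lipschitz in the state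
  and bounded at state 0, and \<open>u\<close>, \<open>D\<^sub>zu\<close> grow at most linearly in \<open>m\<close>, uniformly over bounded sets
  of \<open>z\<close>, there is a square-integrable weight \<open>G(m)\<close>, depending only on \<open>u\<close>, such that the two integrands
  differ by at most a multiple of \<open>G a + G t + a\<^sup>2 + t\<^sup>2\<close>, where \<open>a\<close> and \<open>t\<close> are the pointwise errors
  of the state and of its derivative. To keep \<open>u\<^sub>\<theta>\<close> out of the constants, every occurrence of
  \<open>u\<^sub>\<theta>\<close> outside a difference is bounded through \<open>u\<close>, which produces the quadratic terms.
  The Cauchy-Schwarz inequality handles the linear terms.\<close>

section \<open>Cauchy-Schwarz and differentiation under the integral sign\<close>

lemma
  fixes f g :: "'a \<Rightarrow> real"
  assumes f [measurable]: "f \<in> borel_measurable M" and g [measurable]: "g \<in> borel_measurable M"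
    and f2: "integrable M (\<lambda>x. (f x)\<^sup>2)" and g2: "integrable M (\<lambda>x. (g x)\<^sup>2)"
  shows integrable_mult_L2: "integrable M (\<lambda>x. f x * g x)"
    and Cauchy_Schwarz_integral:
      "(\<integral>x. f x * g x \<partial>M) \<le> sqrt (\<integral>x. (f x)\<^sup>2 \<partial>M) * sqrt (\<integral>x. (g x)\<^sup>2 \<partial>M)"
proof -
  show fg: "integrable M (\<lambda>x. f x * g x)"
  proof (rule Bochner_Integration.integrable_bound)
    show "integrable M (\<lambda>x. (f x)\<^sup>2 + (g x)\<^sup>2)" using f2 g2 by simp
    have "\<bar>f x * g x\<bar> \<le> (f x)\<^sup>2 + (g x)\<^sup>2" for x
      using sum_squares_bound[of "\<bar>f x\<bar>" "\<bar>g x\<bar>"] abs_ge_zero[of "f x * g x"]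
      unfolding abs_mult power2_abs by linarith
    then show "AE x in M. norm (f x * g x) \<le> norm ((f x)\<^sup>2 + (g x)\<^sup>2)" by simp
  qed simp
  define A where "A = (\<integral>x. (f x)\<^sup>2 \<partial>M)"
  define B where "B = (\<integral>x. (g x)\<^sup>2 \<partial>M)"
  define C where "C = (\<integral>x. f x * g x \<partial>M)"
  have AB: "A \<ge> 0" "B \<ge> 0" by (simp_all add: A_def B_def)
  \<comment> \<open>Discriminant argument: the squared \<open>L^2\<close> norm of
    \<open>f - t g\<close> is a nonnegative quadratic in \<open>t\<close>.\<close>
  have quad: "0 \<le> A - 2 * t * C + t\<^sup>2 * B" for t
  proof -
    have "0 \<le> (\<integral>x. (f x - t * g x)\<^sup>2 \<partial>M)" by simp
    also have "\<dots> = (\<integral>x. (f x)\<^sup>2 - 2 * t * (f x * g x) + t\<^sup>2 * (g x)\<^sup>2 \<partial>M)"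
      by (rule Bochner_Integration.integral_cong) (simp_all add: power2_eq_square algebra_simps)
    also have "\<dots> = A - 2 * t * C + t\<^sup>2 * B"
      using f2 g2 fg by (simp add: A_def B_def C_def)
    finally show ?thesis .
  qed
  have "C\<^sup>2 \<le> A * B"
  proof (cases "B = 0")
    case True
    have "C = 0"
    proof (rule ccontr)
      assume "C \<noteq> 0"
      \<comment> \<open>For this \<open>t\<close> the affine function \<open>A - 2 * t * C\<close>
        equals -1.\<close>
      with quad[of "(A + 1) / (2 * C)"] True show False by simp
    qed
    with True show ?thesis by simp
  next
    case False
    \<comment> \<open>The minimiser of the quadratic.\<close>
    with quad[of "C / B"] AB show ?thesis
      by (simp add: field_simps power2_eq_square)
  qed
  then have "C \<le> sqrt (A * B)"
    by (rule real_le_rsqrt)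
  then show "(\<integral>x. f x * g x \<partial>M) \<le> sqrt (\<integral>x. (f x)\<^sup>2 \<partial>M) * sqrt (\<integral>x. (g x)\<^sup>2 \<partial>M)"
    by (simp add: A_def B_def C_def real_sqrt_mult)
qed

text \<open>Dominated convergence is applied to the remainder quotients, which the mean value
  inequality bounds by \<open>2 * g\<close>. The derivative is described direction by direction, so
  that \<open>'b\<close>-valued functions are integrated rather than operator-valued ones.\<close>

lemma has_derivative_lebesgue_integral:
  fixes f :: "'m \<Rightarrow> 'z::real_normed_vector \<Rightarrow> 'b::{banach,second_countable_topology}"
    and f' :: "'m \<Rightarrow> 'z \<Rightarrow> ('z \<Rightarrow>\<^sub>L 'b)"
  assumes r: "r > 0"
    and int: "\<And>y. y \<in> ball z r \<Longrightarrow> integrable M (\<lambda>m. f m y)"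
    and der: "\<And>m y. y \<in> ball z r \<Longrightarrow> (f m has_derivative f' m y) (at y)"
    and bound: "\<And>m y. y \<in> ball z r \<Longrightarrow> norm (f' m y) \<le> g m"
    and g: "integrable M g"
    and meas: "\<And>h. (\<lambda>m. f' m z h) \<in> borel_measurable M"
  shows "((\<lambda>y. \<integral>m. f m y \<partial>M) has_derivative (\<lambda>h. \<integral>m. f' m z h \<partial>M)) (at z)"
proof -
  have zb: "z \<in> ball z r" using r by simp
  have g0: "0 \<le> g m" for m using bound[OF zb, of m] norm_ge_zero order_trans by blast
  have app: "norm (f' m z h) \<le> g m * norm h" for m h
    by (meson bound[OF zb] mult_right_mono norm_blinfun norm_ge_zero order_trans)
  have int': "integrable M (\<lambda>m. f' m z h)" for h
    by (rule Bochner_Integration.integrable_bound[OF integrable_mult_left[OF g, of "norm h"] meas])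
      (use app g0 in \<open>simp add: abs_mult\<close>)
  have "bounded_linear (\<lambda>h. \<integral>m. f' m z h \<partial>M)"
  proof (rule bounded_linear_intro[where K = "\<integral>m. g m \<partial>M"])
    fix h
    have "norm (\<integral>m. f' m z h \<partial>M) \<le> (\<integral>m. norm (f' m z h) \<partial>M)"
      by (rule integral_norm_bound)
    also have "\<dots> \<le> (\<integral>m. g m * norm h \<partial>M)"
      using app g int' by (intro integral_mono) auto
    finally show "norm (\<integral>m. f' m z h \<partial>M) \<le> norm h * (\<integral>m. g m \<partial>M)"
      by (simp add: mult.commute)
  qed (simp_all add: blinfun.add_right blinfun.scaleR_right int')
  \<comment> \<open>Dominated convergence speaks of sequences, so the limit at \<open>z\<close> is
    tested along arbitrary sequences that avoid \<open>z\<close>.\<close>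
  moreover have "((\<lambda>y. ((\<integral>m. f m y \<partial>M) - (\<integral>m. f m z \<partial>M) - (\<integral>m. f' m z (y - z) \<partial>M)) /\<^sub>R norm (y - z)) \<longlongrightarrow> 0) (at z)"
    unfolding tendsto_at_iff_sequentially comp_def
  proof (intro allI impI)
    fix X :: "nat \<Rightarrow> 'z" assume XS: "\<forall>i. X i \<in> UNIV - {z}" and X: "X \<longlonglongrightarrow> z"
    define s where "s i m = (f m (X i) - f m z - f' m z (X i - z)) /\<^sub>R norm (X i - z)" for i m
    have "eventually (\<lambda>i. X i \<in> ball z r) sequentially"
      using X zb by (rule topological_tendstoD[OF _ open_ball])
    then obtain N where N: "X i \<in> ball z r" if "N \<le> i" for i
      by (auto simp: eventually_sequentially)
    \<comment> \<open>Dropping the first \<open>N\<close> terms leaves a sequence inside the ball,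
      where integrability and the bound \<open>g\<close> are available.\<close>
    define Y where "Y i = X (i + N)" for i
    have Y: "Y i \<in> ball z r" "Y i \<noteq> z" for i using N XS by (auto simp: Y_def)
    have Ylim: "Y \<longlonglongrightarrow> z" unfolding Y_def by (rule LIMSEQ_ignore_initial_segment[OF X])
    have ints: "integrable M (s (i + N))" for i
      unfolding s_def using int[OF Y(1)[of i]] int[OF zb] int' by (auto simp: Y_def)
    have "(\<lambda>i. \<integral>m. s (i + N) m \<partial>M) \<longlonglongrightarrow> (\<integral>m. 0 \<partial>M)"
    proof (rule integral_dominated_convergence[where w = "\<lambda>m. 2 * g m"])
      show "(\<lambda>m. 0) \<in> borel_measurable M" "integrable M (\<lambda>m. 2 * g m)" using g by simp_all
      show "s (i + N) \<in> borel_measurable M" for i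
        using ints by (rule borel_measurable_integrable)
      show "AE m in M. (\<lambda>i. s (i + N) m) \<longlonglongrightarrow> 0"
      proof (rule AE_I2)
        fix m
        from der[OF zb, of m] have "((\<lambda>y. (f m y - f m z - f' m z (y - z)) /\<^sub>R norm (y - z)) \<longlongrightarrow> 0) (at z)"
          unfolding has_derivative_at_within by simp
        from this[unfolded tendsto_at_iff_sequentially comp_def, rule_format, of Y] Y(2) Ylim
        show "(\<lambda>i. s (i + N) m) \<longlonglongrightarrow> 0"
          by (simp add: s_def Y_def)
      qed
      show "AE m in M. norm (s (i + N) m) \<le> 2 * g m" for i
      proof (rule AE_I2)
        fix m
        \<comment> \<open>The ball is convex, so the mean value inequality applies; together with
          \<open>app\<close> it yields the factor 2.\<close>
        have "norm (f m (Y i) - f m z) \<le> g m * norm (Y i - z)"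
        proof (rule differentiable_bound[where S = "ball z r" and f' = "\<lambda>y. blinfun_apply (f' m y)"])
          show "(f m has_derivative f' m y) (at y within ball z r)" if "y \<in> ball z r" for y
            using der[OF that] has_derivative_at_withinI by blast
          show "onorm (f' m y) \<le> g m" if "y \<in> ball z r" for y
            using bound[OF that, of m] by (simp add: norm_blinfun.rep_eq)
        qed (use Y zb in auto)
        then have "norm (f m (Y i) - f m z - f' m z (Y i - z)) \<le> 2 * g m * norm (Y i - z)"
          using app[of m "Y i - z"] norm_triangle_ineq4[of "f m (Y i) - f m z" "f' m z (Y i - z)"]
          by linarith
        then show "norm (s (i + N) m) \<le> 2 * g m"
          using Y(2)[of i] by (simp add: s_def Y_def divide_simps)
      qed
    qed
    moreover have "(\<integral>m. s (i + N) m \<partial>M) =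
        ((\<integral>m. f m (Y i) \<partial>M) - (\<integral>m. f m z \<partial>M) - (\<integral>m. f' m z (Y i - z) \<partial>M)) /\<^sub>R norm (Y i - z)" for i
      using int[OF Y(1)[of i]] int[OF zb] int' by (simp add: s_def Y_def)
    ultimately have "(\<lambda>i. ((\<integral>m. f m (Y i) \<partial>M) - (\<integral>m. f m z \<partial>M) - (\<integral>m. f' m z (Y i - z) \<partial>M)) /\<^sub>R norm (Y i - z)) \<longlonglongrightarrow> 0"
      by simp
    then show "(\<lambda>i. ((\<integral>m. f m (X i) \<partial>M) - (\<integral>m. f m z \<partial>M) - (\<integral>m. f' m z (X i - z) \<partial>M)) /\<^sub>R norm (X i - z)) \<longlonglongrightarrow> 0"
      unfolding Y_def by (rule LIMSEQ_offset)
  qed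
  ultimately show ?thesis
    unfolding has_derivative_at_within by simp
qed

section \<open>Growth of maps with Lipschitz derivative\<close>

lemma lipschitz_derivative_growth:
  fixes F' :: "'u::real_normed_vector \<Rightarrow> 'b::real_normed_vector"
  assumes lip: "\<And>w1 w2. norm (F' w2 - F' w1) \<le> K * norm (w2 - w1)"
    and zero: "norm (F' 0) \<le> K"
  shows "norm (F' w) \<le> K * (1 + norm w)"
  using norm_triangle_sub[of "F' w" "F' 0"] lip[of w 0] zero by (simp add: algebra_simps)

text \<open>The mean value inequality on the closed ball about \<open>w1\<close> with
  \<open>w2\<close> on its boundary, where the derivative is controlled by linear growth. The bound
  mentions \<open>w2\<close> only inside a difference; this lets the approximate state play the role
  of \<open>w2\<close> later without entering the constants.\<close>

lemma lipschitz_derivative_increment: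
  fixes F :: "'u::real_normed_vector \<Rightarrow> 'b::real_normed_vector"
    and F' :: "'u \<Rightarrow> ('u \<Rightarrow>\<^sub>L 'b)"
  assumes der: "\<And>w. (F has_derivative F' w) (at w)"
    and lip: "\<And>w1 w2. norm (F' w2 - F' w1) \<le> K * norm (w2 - w1)"
    and zero: "norm (F' 0) \<le> K" and K: "0 \<le> K"
  shows "norm (F w2 - F w1) \<le> K * (1 + norm w1 + norm (w2 - w1)) * norm (w2 - w1)"
proof (rule differentiable_bound[where S = "cball w1 (norm (w2 - w1))" and f' = "\<lambda>w. blinfun_apply (F' w)"])
  fix w assume w: "w \<in> cball w1 (norm (w2 - w1))"
  show "(F has_derivative F' w) (at w within cball w1 (norm (w2 - w1)))"
    using der has_derivative_at_withinI by blast
  have "norm w \<le> norm w1 + norm (w2 - w1)"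
    using w norm_triangle_sub[of w w1] by (simp add: dist_norm norm_minus_commute)
  then have "K * (1 + norm w) \<le> K * (1 + norm w1 + norm (w2 - w1))"
    using K by (intro mult_left_mono) auto
  then show "onorm (F' w) \<le> K * (1 + norm w1 + norm (w2 - w1))"
    using lipschitz_derivative_growth[of F' K w, OF lip zero]
    by (simp add: norm_blinfun.rep_eq)
qed (auto simp: dist_norm norm_minus_commute)

section \<open>Hilbert-Schmidt and \<open>L^2\<close> norms\<close>

text \<open>Expand \<open>x\<close> in the orthonormal basis and apply Cauchy-Schwarz to the
  coordinates. This turns Hilbert-Schmidt hypotheses into operator-norm bounds.\<close>

lemma norm_le_hs_norm:
  fixes T :: "'z::euclidean_space \<Rightarrow>\<^sub>L 'u::real_inner"
  shows "norm T \<le> hs_norm T"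
proof (rule norm_blinfun_bound)
  show "0 \<le> hs_norm T" by (simp add: hs_norm_def sum_nonneg)
  fix x :: 'z
  have "norm (T x) = norm (\<Sum>b\<in>Basis. (x \<bullet> b) *\<^sub>R T b)"
    by (subst euclidean_representation[of x, symmetric])
      (simp add: blinfun.sum_right blinfun.scaleR_right del: euclidean_representation)
  also have "\<dots> \<le> (\<Sum>b\<in>Basis. \<bar>norm (T b)\<bar> * \<bar>x \<bullet> b\<bar>)"
    by (rule sum_norm_le) (simp add: mult.commute)
  also have "\<dots> \<le> L2_set (\<lambda>b. norm (T b)) Basis * L2_set (\<lambda>b. x \<bullet> b) Basis"
    by (rule L2_set_mult_ineq)
  also have "\<dots> = hs_norm T * norm x"
    by (simp add: hs_norm_def L2_set_def norm_eq_sqrt_inner[of x] euclidean_inner[of x x] power2_eq_square)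
  finally show "norm (T x) \<le> hs_norm T * norm x" .
qed

text \<open>Each of the \<open>DIM('z)\<close> summands is at most the squared operator norm. The
  estimate makes the Hilbert-Schmidt error square integrable once operator-norm growth bounds are
  known.\<close>

lemma hs_norm_power2_le:
  fixes T :: "'z::euclidean_space \<Rightarrow>\<^sub>L 'u::real_inner"
  shows "(hs_norm T)\<^sup>2 \<le> DIM('z) * (norm T)\<^sup>2"
proof -
  have "(norm (T b))\<^sup>2 \<le> (norm T)\<^sup>2" if "b \<in> Basis" for b :: 'z
    using norm_blinfun[of T b] that by (intro power_mono) auto
  then have "(\<Sum>b\<in>Basis. (norm (T b))\<^sup>2) \<le> of_nat DIM('z) * (norm T)\<^sup>2"
    by (rule sum_bounded_above)
  then show ?thesis
    by (simp add: hs_norm_def sum_nonneg)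
qed

lemma Lp_norm_2_eq:
  assumes "\<And>x. 0 \<le> N x"
  shows "Lp_norm N 2 \<mu> F = sqrt (\<integral>m. (N (F m))\<^sup>2 \<partial>\<mu>)"
  using assms by (simp add: Lp_norm_def powr_half_sqrt)

section \<open>Derivatives and growth of \<open>Q\<close>\<close>

text \<open>Chain rule along the affine embeddings of one factor into the product. For the mixed
  derivative, restricting an operator to the \<open>z\<close> direction is itself bounded linear, so
  \<open>Dz_Q\<close> inherits differentiability in \<open>w\<close> from
  \<open>fderiv Q\<close>.\<close>

lemma Q_partial_derivatives:
  fixes Q :: "'u::real_normed_vector \<times> 'm::real_normed_vector \<times> 'z::real_normed_vector \<Rightarrow> real"
  assumes C2: "C2_on (UNIV \<times> UNIV \<times> B) Q" and z: "z \<in> B"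
  shows "Du_Q Q w m z h = fderiv Q (w, m, z) (h, 0, 0)"
    and "Dz_Q Q w m z k = fderiv Q (w, m, z) (0, 0, k)"
    and "((\<lambda>w. Q (w, m, z)) has_derivative Du_Q Q w m z) (at w)"
    and "((\<lambda>w. Dz_Q Q w m z) has_derivative Duz_Q Q w m z) (at w)"
proof -
  have dQ: "(Q has_derivative fderiv Q (w, m, z)) (at (w, m, z))" for w
    using C2 z by (auto simp: C2_on_def C1_on_def intro!: fderiv_has_derivative)
  have ddQ: "(fderiv Q has_derivative fderiv (fderiv Q) (w, m, z)) (at (w, m, z))" for w
    using C2 z by (auto simp: C2_on_def C1_on_def intro!: fderiv_has_derivative)
  have du: "((\<lambda>w. (w, m, z)) has_derivative (\<lambda>h. (h, 0, 0))) (at w)" for w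
    by (intro has_derivative_Pair has_derivative_ident has_derivative_const)
  have bz: "bounded_linear (\<lambda>k :: 'z. (0 :: 'u, 0 :: 'm, k))"
    by (intro bounded_linear_Pair bounded_linear_zero bounded_linear_ident)
  have dz: "((\<lambda>z. (w, m, z)) has_derivative (\<lambda>k. (0, 0, k))) (at z)" for w
    by (intro has_derivative_Pair has_derivative_ident has_derivative_const)
  \<comment> \<open>The embeddings are packaged as bounded operators, so that the partial
    derivatives become compositions with \<open>fderiv Q\<close> to which \<open>fderiv_eqI\<close>
    applies.\<close>
  define E where "E = Blinfun (\<lambda>k :: 'z. (0 :: 'u, 0 :: 'm, k))"
  have E: "blinfun_apply E k = (0, 0, k)" for k
    by (simp add: E_def bounded_linear_Blinfun_apply[OF bz])
  have bu: "bounded_linear (\<lambda>h :: 'u. (h, 0 :: 'm, 0 :: 'z))"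
    by (intro bounded_linear_Pair bounded_linear_zero bounded_linear_ident)
  define E' where "E' = Blinfun (\<lambda>h :: 'u. (h, 0 :: 'm, 0 :: 'z))"
  have E': "blinfun_apply E' k = (k, 0, 0)" for k
    by (simp add: E'_def bounded_linear_Blinfun_apply[OF bu])
  have u1: "((\<lambda>w. Q (w, m, z)) has_derivative (fderiv Q (w, m, z) o\<^sub>L E')) (at w)" for w
    by (rule has_derivative_eq_rhs[OF has_derivative_compose[OF du dQ]]) (simp add: E' fun_eq_iff)
  then have Du: "Du_Q Q w m z = fderiv Q (w, m, z) o\<^sub>L E'" for w
    unfolding Du_Q_def by (rule fderiv_eqI)
  then show "Du_Q Q w m z h = fderiv Q (w, m, z) (h, 0, 0)" by (simp add: E')
  show "((\<lambda>w. Q (w, m, z)) has_derivative Du_Q Q w m z) (at w)"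
    using u1 Du by simp
  have "((\<lambda>z. Q (w, m, z)) has_derivative (fderiv Q (w, m, z) o\<^sub>L E)) (at z)" for w
    by (rule has_derivative_eq_rhs[OF has_derivative_compose[OF dz dQ]]) (simp add: E fun_eq_iff)
  then have Dz: "Dz_Q Q w m z = fderiv Q (w, m, z) o\<^sub>L E" for w
    unfolding Dz_Q_def by (rule fderiv_eqI)
  then show "Dz_Q Q w m z k = fderiv Q (w, m, z) (0, 0, k)" by (simp add: E)
  have bl: "bounded_linear (\<lambda>T. T o\<^sub>L E)"
    by (rule bounded_bilinear.bounded_linear_left[OF bounded_bilinear_blinfun_compose])
  have "((\<lambda>w. fderiv Q (w, m, z) o\<^sub>L E) has_derivative
      (\<lambda>h. fderiv (fderiv Q) (w, m, z) (h, 0, 0) o\<^sub>L E)) (at w)"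
    by (rule bounded_linear.has_derivative[OF bl has_derivative_compose[OF du ddQ]])
  \<comment> \<open>Differentiability is enough here, since \<open>Duz_Q\<close> is by definition
    the \<open>fderiv\<close> of this map.\<close>
  then have "(\<lambda>w. Dz_Q Q w m z) differentiable (at w)"
    unfolding Dz differentiable_def by blast
  then show "((\<lambda>w. Dz_Q Q w m z) has_derivative Duz_Q Q w m z) (at w)"
    unfolding Duz_Q_def by (rule fderiv_has_derivative)
qed

text \<open>The Lipschitz bounds and the bounds at state 0 make \<open>Du_Q\<close> and
  \<open>Duz_Q\<close> grow linearly in the state. As these are the state derivatives of
  \<open>Q\<close> and \<open>Dz_Q\<close>, the latter grow quadratically. One constant
  \<open>K\<close> serves all estimates.\<close>

lemma assumption_B_growth:
  fixes Q :: "'u::{real_inner,banach,second_countable_topology}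
    \<times> 'm::{real_inner,banach,second_countable_topology} \<times> 'z::euclidean_space \<Rightarrow> real"
  assumes AB: "assumption_B Zad B Q"
  obtains K where "0 \<le> K"
    and "\<And>w m z. z \<in> B \<Longrightarrow> \<bar>Q (w, m, z)\<bar> \<le> K * (1 + norm w)\<^sup>2"
    and "\<And>w m z. z \<in> B \<Longrightarrow> norm (Du_Q Q w m z) \<le> K * (1 + norm w)"
    and "\<And>w m z. z \<in> B \<Longrightarrow> norm (Dz_Q Q w m z) \<le> K * (1 + norm w)\<^sup>2"
    and "\<And>w1 w2 m z. z \<in> B \<Longrightarrow> norm (Du_Q Q w2 m z - Du_Q Q w1 m z) \<le> K * norm (w2 - w1)"
    and "\<And>w1 w2 m z. z \<in> B \<Longrightarrow>
      norm (Dz_Q Q w2 m z - Dz_Q Q w1 m z) \<le> K * (1 + norm w1 + norm (w2 - w1)) * norm (w2 - w1)"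
proof -
  from AB have C2: "C2_on (UNIV \<times> UNIV \<times> B) Q" by (simp add: assumption_B_def)
  from AB obtain \<kappa>1 \<kappa>2 where \<kappa>: "\<kappa>1 > 0" "\<kappa>2 > 0"
    "\<And>w1 w2 m z. z \<in> B \<Longrightarrow> norm (Du_Q Q w2 m z - Du_Q Q w1 m z) \<le> \<kappa>1 * norm (w2 - w1)"
    "\<And>w1 w2 m z. z \<in> B \<Longrightarrow> norm (Duz_Q Q w2 m z - Duz_Q Q w1 m z) \<le> \<kappa>2 * norm (w2 - w1)"
    unfolding assumption_B_def by blast
  from AB obtain M0 M1 M2 M3 where M: "M0 \<ge> 0" "M1 \<ge> 0" "M2 \<ge> 0" "M3 \<ge> 0"
    "\<And>m z. z \<in> B \<Longrightarrow> \<bar>Q (0, m, z)\<bar> \<le> M0"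
    "\<And>m z. z \<in> B \<Longrightarrow> norm (Du_Q Q 0 m z) \<le> M1"
    "\<And>m z. z \<in> B \<Longrightarrow> norm (Dz_Q Q 0 m z) \<le> M2"
    "\<And>m z. z \<in> B \<Longrightarrow> norm (Duz_Q Q 0 m z) \<le> M3"
    unfolding assumption_B_def by blast
  define K where "K = \<kappa>1 + \<kappa>2 + M0 + M1 + M2 + M3"
  have K: "0 \<le> K" "\<kappa>1 \<le> K" "\<kappa>2 \<le> K" "M0 \<le> K" "M1 \<le> K" "M2 \<le> K" "M3 \<le> K"
    using \<kappa>(1,2) M(1-4) by (simp_all add: K_def)
  have lu: "norm (Du_Q Q w2 m z - Du_Q Q w1 m z) \<le> K * norm (w2 - w1)" if "z \<in> B" for w1 w2 m z
    using \<kappa>(3)[OF that] K(2) by (meson mult_right_mono norm_ge_zero order_trans)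
  have luz: "norm (Duz_Q Q w2 m z - Duz_Q Q w1 m z) \<le> K * norm (w2 - w1)" if "z \<in> B" for w1 w2 m z
    using \<kappa>(4)[OF that] K(3) by (meson mult_right_mono norm_ge_zero order_trans)
  have u0: "norm (Du_Q Q 0 m z) \<le> K" and uz0: "norm (Duz_Q Q 0 m z) \<le> K"
    and q0: "\<bar>Q (0, m, z)\<bar> \<le> K" and z0: "norm (Dz_Q Q 0 m z) \<le> K" if "z \<in> B" for m z
    using M(5-8)[OF that, of m] K(4-7) by linarith+
  have incQ: "norm (Q (w2, m, z) - Q (w1, m, z)) \<le> K * (1 + norm w1 + norm (w2 - w1)) * norm (w2 - w1)"
    if "z \<in> B" for w1 w2 m z
    using lipschitz_derivative_increment[where F = "\<lambda>w. Q (w, m, z)", OF Q_partial_derivatives(3)[OF C2 that] lu[OF that] u0[OF that] K(1)] .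
  have incz: "norm (Dz_Q Q w2 m z - Dz_Q Q w1 m z) \<le> K * (1 + norm w1 + norm (w2 - w1)) * norm (w2 - w1)"
    if "z \<in> B" for w1 w2 m z
    using lipschitz_derivative_increment[where F = "\<lambda>w. Dz_Q Q w m z", OF Q_partial_derivatives(4)[OF C2 that] luz[OF that] uz0[OF that] K(1)] .
  \<comment> \<open>Combines the value at state 0 with the increment from 0, for both
    \<open>Q\<close> and \<open>Dz_Q\<close>.\<close>
  have aux: "K + K * (1 + norm w) * norm w \<le> K * (1 + norm w)\<^sup>2" for w :: 'u
    using K(1) by (simp add: power2_eq_square algebra_simps)
  show thesis
  proof (rule that)
    show "\<bar>Q (w, m, z)\<bar> \<le> K * (1 + norm w)\<^sup>2" if "z \<in> B" for w m z
      using incQ[OF that, of w m 0] q0[OF that, of m] aux[of w] by (simp add: algebra_simps)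
    show "norm (Dz_Q Q w m z) \<le> K * (1 + norm w)\<^sup>2" if "z \<in> B" for w m z
      using incz[OF that, of w m 0] z0[OF that, of m] aux[of w] norm_triangle_sub[of "Dz_Q Q w m z" "Dz_Q Q 0 m z"]
      by (simp add: algebra_simps)
    show "norm (Du_Q Q w m z) \<le> K * (1 + norm w)" if "z \<in> B" for w m z
      using lipschitz_derivative_growth[OF lu[OF that] u0[OF that]] .
  qed (fact K(1) lu incz)+
qed

section \<open>The gradient of the integrand and the growth of the states\<close>

text \<open>The chain-rule derivative in \<open>z\<close> of the integrand
  \<open>Q (u (m, z), m, z)\<close>.\<close>

definition reduced_gradient ::
  "('u::real_normed_vector \<times> 'm \<times> 'z::real_normed_vector \<Rightarrow> real) \<Rightarrow> ('m \<times> 'z \<Rightarrow> 'u) \<Rightarrow> 'm \<Rightarrow> 'z \<Rightarrow> ('z \<Rightarrow>\<^sub>L real)" where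
  "reduced_gradient Q u m z = (Du_Q Q (u (m, z)) m z o\<^sub>L Dz_state u m z) + Dz_Q Q (u (m, z)) m z"

lemma Dz_state_has_derivative:
  fixes u :: "'m::real_normed_vector \<times> 'z::real_normed_vector \<Rightarrow> 'u::real_normed_vector"
  assumes "C1_on (UNIV \<times> B) u" and "z \<in> B"
  shows "((\<lambda>z. u (m, z)) has_derivative Dz_state u m z) (at z)"
proof -
  have "(u has_derivative fderiv u (m, z)) (at (m, z))"
    using assms by (auto simp: C1_on_def intro!: fderiv_has_derivative)
  moreover have "((\<lambda>z. (m, z)) has_derivative (\<lambda>k. (0, k))) (at z)"
    by (intro has_derivative_Pair has_derivative_ident has_derivative_const)
  ultimately have "((\<lambda>z. u (m, z)) has_derivative (\<lambda>k. fderiv u (m, z) (0, k))) (at z)"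
    by (rule has_derivative_compose[rotated])
  then have "(\<lambda>z. u (m, z)) differentiable (at z)"
    unfolding differentiable_def by blast
  then show ?thesis
    unfolding Dz_state_def by (rule fderiv_has_derivative)
qed

text \<open>The sum of partial derivatives in the definition suits norm bounds. The formula with a
  single \<open>fderiv Q\<close> suits the chain rule and measurability, because
  \<open>fderiv Q\<close> is continuous.\<close>

lemma
  fixes Q :: "'u::real_normed_vector \<times> 'm::real_normed_vector \<times> 'z::real_normed_vector \<Rightarrow> real"
  assumes Q: "C2_on (UNIV \<times> UNIV \<times> B) Q" and u: "C1_on (UNIV \<times> B) u" and z: "z \<in> B"
  shows reduced_gradient_apply:
      "reduced_gradient Q u m z h = fderiv Q (u (m, z), m, z) (Dz_state u m z h, 0, h)"
    and reduced_gradient_has_derivative: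
      "((\<lambda>z. Q (u (m, z), m, z)) has_derivative reduced_gradient Q u m z) (at z)"
proof -
  show app: "reduced_gradient Q u m z h = fderiv Q (u (m, z), m, z) (Dz_state u m z h, 0, h)" for h
  proof -
    have "reduced_gradient Q u m z h =
        fderiv Q (u (m, z), m, z) (Dz_state u m z h, 0, 0) + fderiv Q (u (m, z), m, z) (0, 0, h)"
      by (simp add: reduced_gradient_def blinfun.add_left Q_partial_derivatives(1,2)[OF Q z])
    also have "\<dots> = fderiv Q (u (m, z), m, z) (Dz_state u m z h, 0, h)"
      by (simp flip: blinfun.add_right)
    finally show ?thesis .
  qed
  have "(Q has_derivative fderiv Q (u (m, z), m, z)) (at (u (m, z), m, z))"
    using Q z by (auto simp: C2_on_def C1_on_def intro!: fderiv_has_derivative)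
  moreover have "((\<lambda>z. (u (m, z), m, z)) has_derivative (\<lambda>h. (Dz_state u m z h, 0, h))) (at z)"
    by (intro has_derivative_Pair has_derivative_ident has_derivative_const Dz_state_has_derivative[OF u z])
  ultimately have "((\<lambda>z. Q (u (m, z), m, z)) has_derivative
      (\<lambda>h. fderiv Q (u (m, z), m, z) (Dz_state u m z h, 0, h))) (at z)"
    by (rule has_derivative_compose[rotated])
  then show "((\<lambda>z. Q (u (m, z), m, z)) has_derivative reduced_gradient Q u m z) (at z)"
    by (simp add: app[abs_def] eta_contract_eq)
qed

text \<open>Compare \<open>F m z\<close> with its value at one reference point
  \<open>(0, z0)\<close>. Since \<open>S\<close> is bounded, the parameter distance is at most
  \<open>2 * d\<close>, and only growth in \<open>m\<close> is left.\<close>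

lemma lipschitz_linear_growth:
  fixes F :: "'m::real_normed_vector \<Rightarrow> 'z::real_normed_vector \<Rightarrow> 'b::real_normed_vector"
  assumes lip: "\<And>z1 z2 m1 m2. z1 \<in> B \<Longrightarrow> z2 \<in> B \<Longrightarrow>
      norm (F m2 z2 - F m1 z1) \<le> \<kappa> * (norm (m2 - m1) + norm (z2 - z1))"
    and \<kappa>: "0 < \<kappa>" and S: "bounded S" "S \<subseteq> B"
  shows "\<exists>R\<ge>0. \<forall>z\<in>S. \<forall>m. norm (F m z) \<le> R * (1 + norm m)"
proof (cases "S = {}")
  case False
  then obtain z0 where z0: "z0 \<in> S" by blast
  from S(1) obtain d where d: "\<And>z. z \<in> S \<Longrightarrow> norm z \<le> d" by (auto simp: bounded_iff)
  have d0: "0 \<le> d" using d[OF z0] norm_ge_zero order_trans by blast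
  define R where "R = \<kappa> + norm (F 0 z0) + \<kappa> * (2 * d)"
  have R: "\<kappa> \<le> R" "0 \<le> R" "norm (F 0 z0) + \<kappa> * (2 * d) \<le> R"
    using \<kappa> d0 by (simp_all add: R_def)
  have "norm (F m z) \<le> R * (1 + norm m)" if z: "z \<in> S" for m z
  proof -
    have "norm (F m z - F 0 z0) \<le> \<kappa> * (norm (m - 0) + norm (z - z0))"
      using lip z z0 S(2) by blast
    also have "\<dots> \<le> \<kappa> * (norm m + 2 * d)"
      using norm_triangle_ineq4[of z z0] d[OF z] d[OF z0] \<kappa> by (intro mult_left_mono) auto
    finally have "norm (F m z) \<le> norm (F 0 z0) + \<kappa> * (2 * d) + \<kappa> * norm m"
      using norm_triangle_sub[of "F m z" "F 0 z0"] by (simp add: distrib_left)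
    also have "\<dots> \<le> R + R * norm m"
      using R by (intro add_mono mult_right_mono) auto
    finally show ?thesis by (simp add: distrib_left)
  qed
  with R(2) show ?thesis by blast
qed auto

text \<open>\<open>S\<close> is \<open>Zad\<close> in the final estimate and a small ball around
  \<open>z\<close> when differentiating under the integral.\<close>

lemma assumption_A_growth:
  fixes u :: "'m::{real_inner,banach,second_countable_topology} \<times> 'z::euclidean_space
    \<Rightarrow> 'u::{real_inner,banach,second_countable_topology}"
  assumes A: "assumption_A \<mu> Zad B p u" and S: "bounded S" "S \<subseteq> B"
  obtains R where "0 \<le> R"
    and "\<And>m z. z \<in> S \<Longrightarrow> norm (u (m, z)) \<le> R * (1 + norm m)"
    and "\<And>m z. z \<in> S \<Longrightarrow> norm (Dz_state u m z) \<le> R * (1 + norm m)"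
proof -
  from A obtain \<kappa> \<kappa>' where \<kappa>: "\<kappa> > 0" "\<kappa>' > 0"
    "\<And>z1 z2 m1 m2. z1 \<in> B \<Longrightarrow> z2 \<in> B \<Longrightarrow>
      norm (u (m2, z2) - u (m1, z1)) \<le> \<kappa> * (norm (m2 - m1) + norm (z2 - z1))"
    "\<And>z1 z2 m1 m2. z1 \<in> B \<Longrightarrow> z2 \<in> B \<Longrightarrow>
      hs_norm (Dz_state u m2 z2 - Dz_state u m1 z1) \<le> \<kappa>' * (norm (m2 - m1) + norm (z2 - z1))"
    unfolding assumption_A_def by blast
  obtain R1 where R1: "0 \<le> R1" "\<And>m z. z \<in> S \<Longrightarrow> norm (u (m, z)) \<le> R1 * (1 + norm m)"
    using lipschitz_linear_growth[of B "\<lambda>m z. u (m, z)", OF \<kappa>(3) \<kappa>(1) S] by blast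
  obtain R2 where R2: "0 \<le> R2" "\<And>m z. z \<in> S \<Longrightarrow> norm (Dz_state u m z) \<le> R2 * (1 + norm m)"
    using lipschitz_linear_growth[of B "Dz_state u", OF order_trans[OF norm_le_hs_norm \<kappa>(4)] \<kappa>(2) S] by blast
  show thesis
  proof (rule that[of "max R1 R2"])
    show "0 \<le> max R1 R2" using R1(1) by simp
    fix m z assume z: "z \<in> S"
    show "norm (u (m, z)) \<le> max R1 R2 * (1 + norm m)"
      using R1(2)[OF z, of m] by (rule order_trans) (simp add: mult_right_mono)
    show "norm (Dz_state u m z) \<le> max R1 R2 * (1 + norm m)"
      using R2(2)[OF z, of m] by (rule order_trans) (simp add: mult_right_mono)
  qed
qed

text \<open>Lipschitz dependence on \<open>m\<close> is the source of the Borel measurability of the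
  integrands built from the state.\<close>

lemma assumption_A_continuous:
  fixes u :: "'m::{real_inner,banach,second_countable_topology} \<times> 'z::euclidean_space
    \<Rightarrow> 'u::{real_inner,banach,second_countable_topology}"
  assumes A: "assumption_A \<mu> Zad B p u" and z: "z \<in> B"
  shows "continuous_on UNIV (\<lambda>m. u (m, z))" and "continuous_on UNIV (\<lambda>m. Dz_state u m z)"
proof -
  from A obtain \<kappa> \<kappa>' where \<kappa>: "\<kappa> > 0" "\<kappa>' > 0"
    "\<And>z1 z2 m1 m2. z1 \<in> B \<Longrightarrow> z2 \<in> B \<Longrightarrow>
      norm (u (m2, z2) - u (m1, z1)) \<le> \<kappa> * (norm (m2 - m1) + norm (z2 - z1))"
    "\<And>z1 z2 m1 m2. z1 \<in> B \<Longrightarrow> z2 \<in> B \<Longrightarrow>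
      hs_norm (Dz_state u m2 z2 - Dz_state u m1 z1) \<le> \<kappa>' * (norm (m2 - m1) + norm (z2 - z1))"
    unfolding assumption_A_def by blast
  have "\<kappa>-lipschitz_on UNIV (\<lambda>m. u (m, z))"
    using \<kappa>(1) \<kappa>(3)[OF z z] by (intro lipschitz_onI) (auto simp: dist_norm)
  then show "continuous_on UNIV (\<lambda>m. u (m, z))" by (rule lipschitz_on_continuous_on)
  have "\<kappa>'-lipschitz_on UNIV (\<lambda>m. Dz_state u m z)"
    using \<kappa>(2) \<kappa>(4)[OF z z] norm_le_hs_norm
    by (intro lipschitz_onI) (auto simp: dist_norm intro: order_trans)
  then show "continuous_on UNIV (\<lambda>m. Dz_state u m z)" by (rule lipschitz_on_continuous_on)
qed

text \<open>Along the state, \<open>Du_Q\<close> and \<open>Dz_state\<close> each grow linearly in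
  \<open>norm m\<close>, while \<open>Q\<close> and \<open>Dz_Q\<close> grow quadratically. Hence
  the square of \<open>1 + norm m\<close> dominates everything, and a second moment is what
  integrability asks for.\<close>

lemma reduced_gradient_growth:
  fixes Q :: "'u::{real_inner,banach,second_countable_topology}
    \<times> 'm::{real_inner,banach,second_countable_topology} \<times> 'z::euclidean_space \<Rightarrow> real"
  assumes A: "assumption_A \<mu> Zad B p u" and AB: "assumption_B Zad B Q"
    and S: "bounded S" "S \<subseteq> B"
  obtains C where "0 \<le> C"
    and "\<And>m z. z \<in> S \<Longrightarrow> \<bar>Q (u (m, z), m, z)\<bar> \<le> C * (1 + norm m)\<^sup>2"
    and "\<And>m z. z \<in> S \<Longrightarrow> norm (reduced_gradient Q u m z) \<le> C * (1 + norm m)\<^sup>2"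
proof -
  obtain K where K: "0 \<le> K"
    "\<And>w m z. z \<in> B \<Longrightarrow> \<bar>Q (w, m, z)\<bar> \<le> K * (1 + norm w)\<^sup>2"
    "\<And>w m z. z \<in> B \<Longrightarrow> norm (Du_Q Q w m z) \<le> K * (1 + norm w)"
    "\<And>w m z. z \<in> B \<Longrightarrow> norm (Dz_Q Q w m z) \<le> K * (1 + norm w)\<^sup>2"
    using assumption_B_growth[OF AB] by metis
  obtain R where R: "0 \<le> R"
    "\<And>m z. z \<in> S \<Longrightarrow> norm (u (m, z)) \<le> R * (1 + norm m)"
    "\<And>m z. z \<in> S \<Longrightarrow> norm (Dz_state u m z) \<le> R * (1 + norm m)"
    using assumption_A_growth[OF A S] by metis
  \<comment> \<open>The factor 2 gives one share to each summand of the gradient.\<close>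
  define C where "C = 2 * K * (1 + R)\<^sup>2"
  have w: "1 + norm (u (m, z)) \<le> (1 + R) * (1 + norm m)" if "z \<in> S" for m z
    using R(2)[OF that, of m] norm_ge_zero[of m] by (simp add: algebra_simps del: norm_ge_zero)
  have w2: "K * (1 + norm (u (m, z)))\<^sup>2 \<le> K * (1 + R)\<^sup>2 * (1 + norm m)\<^sup>2" if "z \<in> S" for m z
    using power_mono[OF w[OF that], where n = 2] K(1) by (simp add: power_mult_distrib mult_left_mono mult.assoc)
  show thesis
  proof (rule that)
    show "0 \<le> C" using K(1) by (simp add: C_def)
    fix m :: 'm and z assume z: "z \<in> S"
    then have zB: "z \<in> B" using S by blast
    have "0 \<le> K * (1 + R)\<^sup>2 * (1 + norm m)\<^sup>2" using K(1) by simp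
    then show "\<bar>Q (u (m, z), m, z)\<bar> \<le> C * (1 + norm m)\<^sup>2"
      using K(2)[OF zB, of "u (m, z)" m] w2[OF z, of m] by (simp add: C_def)
    have "norm (Du_Q Q (u (m, z)) m z o\<^sub>L Dz_state u m z) \<le> norm (Du_Q Q (u (m, z)) m z) * norm (Dz_state u m z)"
      by (rule norm_blinfun_compose)
    also have "\<dots> \<le> (K * ((1 + R) * (1 + norm m))) * (R * (1 + norm m))"
      using K(1) R(1)
      by (intro mult_mono order_trans[OF K(3)[OF zB]] mult_left_mono w[OF z] R(3)[OF z]) auto
    also have "\<dots> \<le> (K * ((1 + R) * (1 + norm m))) * ((1 + R) * (1 + norm m))"
      using K(1) R(1) by (intro mult_left_mono) (auto simp: algebra_simps)
    also have "\<dots> = K * (1 + R)\<^sup>2 * (1 + norm m)\<^sup>2" by (simp add: power2_eq_square)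
    finally show "norm (reduced_gradient Q u m z) \<le> C * (1 + norm m)\<^sup>2"
      using norm_triangle_ineq[of "Du_Q Q (u (m, z)) m z o\<^sub>L Dz_state u m z" "Dz_Q Q (u (m, z)) m z"]
        K(4)[OF zB, of "u (m, z)" m] w2[OF z, of m]
      by (simp add: C_def reduced_gradient_def)
  qed
qed

section \<open>Integrability and differentiability of the mean objective\<close>

text \<open>Where \<open>norm m \<le> 1\<close> the square is at most 4; elsewhere
  \<open>1 + norm m\<close> is at most \<open>2 * norm m\<close>, and \<open>2 \<le> p\<close>
  compares the powers.\<close>

lemma integrable_second_moment:
  fixes \<mu> :: "'m::{real_normed_vector,second_countable_topology} measure"
  assumes "prob_space \<mu>" and sets: "sets \<mu> = sets borel"
    and p: "2 \<le> p" and int: "integrable \<mu> (\<lambda>m. norm m powr p)"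
  shows "integrable \<mu> (\<lambda>m. (1 + norm m)\<^sup>2)"
proof -
  interpret prob_space \<mu> by fact
  have [measurable]: "(\<lambda>m. m) \<in> borel_measurable \<mu>"
    by (simp add: measurable_cong_sets[OF sets refl])
  show ?thesis
  proof (rule Bochner_Integration.integrable_bound)
    show "integrable \<mu> (\<lambda>m. 4 + 4 * norm m powr p)" using int by simp
    have "(1 + norm m)\<^sup>2 \<le> 4 + 4 * norm m powr p" for m :: 'm
    proof (cases "norm m \<le> 1")
      case True
      then have "(1 + norm m)\<^sup>2 \<le> 2\<^sup>2" by (intro power_mono) auto
      then show ?thesis by (simp add: add_increasing2)
    next
      case False
      then have "(1 + norm m)\<^sup>2 \<le> (2 * norm m)\<^sup>2" by (intro power_mono) auto
      moreover have "norm m powr 2 \<le> norm m powr p" using False p by (intro powr_mono) auto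
      moreover have "norm m powr 2 = (norm m)\<^sup>2" by simp
      ultimately show ?thesis by (simp add: power_mult_distrib)
    qed
    then show "AE m in \<mu>. norm ((1 + norm m)\<^sup>2) \<le> norm (4 + 4 * norm m powr p)" by simp
  qed measurable
qed

text \<open>On a ball around \<open>z\<close> inside \<open>B\<close>, a multiple of
  \<open>(1 + norm m)^2\<close> dominates both the integrand and its gradient. It is integrable by
  the moment condition, so the derivative passes under the integral.\<close>

lemma
  fixes Q :: "'u::{real_inner,banach,second_countable_topology}
    \<times> 'm::{real_inner,banach,second_countable_topology} \<times> 'z::euclidean_space \<Rightarrow> real"
  assumes A: "assumption_A \<mu> Zad B p u" and AB: "assumption_B Zad B Q" and p: "2 \<le> p"
    and z: "z \<in> B"
  shows integrable_quantity_of_interest: "integrable \<mu> (\<lambda>m. Q (u (m, z), m, z))"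
    and integrable_reduced_gradient: "integrable \<mu> (\<lambda>m. reduced_gradient Q u m z h)"
    and J_mean_has_derivative:
      "(J_mean \<mu> Q u has_derivative (\<lambda>h. \<integral>m. reduced_gradient Q u m z h \<partial>\<mu>)) (at z)"
proof -
  from A have pr: "prob_space \<mu>" and sets: "sets \<mu> = sets borel" and B: "open B"
    and u: "C1_on (UNIV \<times> B) u" and mom: "integrable \<mu> (\<lambda>m. norm m powr p)"
    by (simp_all add: assumption_A_def)
  from AB have Q: "C2_on (UNIV \<times> UNIV \<times> B) Q" by (simp add: assumption_B_def)
  note meas_eq = measurable_cong_sets[OF sets refl]
  note sq = integrable_second_moment[OF pr sets p mom]
  obtain r where r: "r > 0" "ball z r \<subseteq> B" using B z by (meson openE)
  obtain C where C: "0 \<le> C"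
    "\<And>m y. y \<in> ball z r \<Longrightarrow> \<bar>Q (u (m, y), m, y)\<bar> \<le> C * (1 + norm m)\<^sup>2"
    "\<And>m y. y \<in> ball z r \<Longrightarrow> norm (reduced_gradient Q u m y) \<le> C * (1 + norm m)\<^sup>2"
    using reduced_gradient_growth[OF A AB bounded_ball r(2)] by metis
  have dom: "integrable \<mu> (\<lambda>m. C * (1 + norm m)\<^sup>2)" using sq by simp
  have cont: "continuous_on UNIV (\<lambda>m. (u (m, y), m, y))" if "y \<in> B" for y
    by (intro continuous_intros assumption_A_continuous[OF A that])
  have "continuous_on (UNIV \<times> UNIV \<times> B) Q"
    using Q by (auto simp: C2_on_def C1_on_def intro!: continuous_at_imp_continuous_on
        differentiable_imp_continuous_within)
  then have contQ: "continuous_on UNIV (\<lambda>m. Q (u (m, y), m, y))" if "y \<in> B" for y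
    by (rule continuous_on_compose2[OF _ cont[OF that]]) (use that in auto)
  have intQ: "integrable \<mu> (\<lambda>m. Q (u (m, y), m, y))" if "y \<in> ball z r" for y
  proof (rule Bochner_Integration.integrable_bound[OF dom])
    show "(\<lambda>m. Q (u (m, y), m, y)) \<in> borel_measurable \<mu>"
      unfolding meas_eq using contQ that r(2) by (blast intro: borel_measurable_continuous_onI)
    show "AE m in \<mu>. norm (Q (u (m, y), m, y)) \<le> norm (C * (1 + norm m)\<^sup>2)"
      using C(1) C(2)[OF that] by (simp add: abs_mult)
  qed
  then show "integrable \<mu> (\<lambda>m. Q (u (m, z), m, z))" using r(1) by simp
  \<comment> \<open>The single-\<open>fderiv\<close> form of the gradient is continuous in
    \<open>m\<close> for fixed \<open>z\<close> and \<open>h\<close>, hence measurable.\<close>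
  have "continuous_on (UNIV \<times> UNIV \<times> B) (fderiv Q)"
    using Q by (simp add: C2_on_def C1_on_def)
  then have "continuous_on UNIV (\<lambda>m. fderiv Q (u (m, z), m, z))"
    by (rule continuous_on_compose2[OF _ cont[OF z]]) (use z in auto)
  then have "continuous_on UNIV (\<lambda>m. fderiv Q (u (m, z), m, z) (Dz_state u m z h, 0, h))" for h
    by (intro continuous_intros assumption_A_continuous[OF A z])
  then have meas: "(\<lambda>m. reduced_gradient Q u m z h) \<in> borel_measurable \<mu>" for h
    unfolding meas_eq reduced_gradient_apply[OF Q u z] by (rule borel_measurable_continuous_onI)
  show "integrable \<mu> (\<lambda>m. reduced_gradient Q u m z h)"
  proof (rule Bochner_Integration.integrable_bound[OF integrable_mult_left[OF dom, of "norm h"] meas])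
    have "norm (reduced_gradient Q u m z h) \<le> C * (1 + norm m)\<^sup>2 * norm h" for m
      using norm_blinfun[of "reduced_gradient Q u m z" h] C(3)[of z m] r(1)
      by (meson centre_in_ball mult_right_mono norm_ge_zero order_trans)
    then show "AE m in \<mu>. norm (reduced_gradient Q u m z h) \<le> norm (C * (1 + norm m)\<^sup>2 * norm h)"
      using C(1) by (simp add: abs_mult)
  qed
  have "((\<lambda>y. \<integral>m. Q (u (m, y), m, y) \<partial>\<mu>) has_derivative (\<lambda>h. \<integral>m. reduced_gradient Q u m z h \<partial>\<mu>)) (at z)"
    by (rule has_derivative_lebesgue_integral[where f = "\<lambda>m y. Q (u (m, y), m, y)" and f' = "reduced_gradient Q u",
          OF r(1) intQ _ C(3) dom meas])
      (use reduced_gradient_has_derivative[OF Q u] r(2) in auto)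
  then show "(J_mean \<mu> Q u has_derivative (\<lambda>h. \<integral>m. reduced_gradient Q u m z h \<partial>\<mu>)) (at z)"
    by (simp add: J_mean_def[abs_def])
qed

section \<open>The gradient error, first pointwise and then in the mean\<close>

text \<open>Products are split so that each error is multiplied by norms of the \<open>u\<close>
  quantities or by another error. The number \<open>t\<close> is any upper bound for the operator
  norm of the derivative error, so that the Hilbert-Schmidt norm can be inserted.\<close>

lemma reduced_gradient_diff_le:
  assumes K: "0 \<le> K"
    and Du: "norm (Du_Q Q w m z) \<le> K * (1 + norm w)"
    and Du_lip: "norm (Du_Q Q w' m z - Du_Q Q w m z) \<le> K * norm (w' - w)"
    and Dz_lip: "norm (Dz_Q Q w' m z - Dz_Q Q w m z) \<le> K * (1 + norm w + norm (w' - w)) * norm (w' - w)"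
    and w: "w = u (m, z)" "1 + norm w \<le> G" and T: "norm (Dz_state u m z) \<le> G"
    and w': "w' = v (m, z)" and t: "norm (Dz_state u m z - Dz_state v m z) \<le> t"
  shows "norm (reduced_gradient Q u m z - reduced_gradient Q v m z)
    \<le> 2 * K * (G * norm (w - w') + G * t) + 2 * K * ((norm (w - w'))\<^sup>2 + t\<^sup>2)"
proof -
  define a where "a = norm (w - w')"
  define T where "T = Dz_state u m z"
  define T' where "T' = Dz_state v m z"
  have a: "norm (w' - w) = a" "0 \<le> a" by (simp_all add: a_def norm_minus_commute)
  have G: "0 \<le> G" using w(2) norm_ge_zero[of w] by linarith
  have t0: "0 \<le> t" using t norm_ge_zero order_trans by blast
  \<comment> \<open>Trades the derivative of \<open>v\<close> for that of \<open>u\<close> plus the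
    error, so that \<open>G\<close> can be chosen from \<open>u\<close> alone.\<close>
  have T': "norm T' \<le> G + t"
    using norm_triangle_sub[of T' T] T t by (simp add: T_def T'_def norm_minus_commute)
  \<comment> \<open>The difference of products is split by inserting \<open>Du_Q Q w m z\<close>
    composed with \<open>T'\<close>.\<close>
  have eq: "reduced_gradient Q u m z - reduced_gradient Q v m z
      = (Du_Q Q w m z o\<^sub>L (T - T')) - ((Du_Q Q w' m z - Du_Q Q w m z) o\<^sub>L T')
        - (Dz_Q Q w' m z - Dz_Q Q w m z)"
    by (simp add: reduced_gradient_def w(1) w' T_def T'_def blinfun_eqI blinfun.diff_left blinfun.add_left
        blinfun.diff_right)
  have "norm (Du_Q Q w m z o\<^sub>L (T - T')) \<le> (K * G) * t"
  proof (rule order_trans[OF norm_blinfun_compose mult_mono])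
    show "norm (Du_Q Q w m z) \<le> K * G"
      using Du mult_left_mono[OF w(2) K] by linarith
  qed (use t K G in \<open>auto simp: T_def T'_def\<close>)
  moreover have "norm ((Du_Q Q w' m z - Du_Q Q w m z) o\<^sub>L T') \<le> (K * a) * (G + t)"
    using Du_lip T' K a by (intro order_trans[OF norm_blinfun_compose mult_mono]) auto
  moreover have "norm (Dz_Q Q w' m z - Dz_Q Q w m z) \<le> K * (G + a) * a"
    using Dz_lip w(2) K unfolding a(1)
    by (elim order_trans) (intro mult_right_mono mult_left_mono a(2), auto)
  ultimately have "norm (reduced_gradient Q u m z - reduced_gradient Q v m z)
      \<le> (K * G) * t + (K * a) * (G + t) + K * (G + a) * a"
    unfolding eq by (smt (verit) norm_triangle_ineq4)
  also have "\<dots> = K * (G * t) + 2 * K * (G * a) + K * (a * t) + K * a\<^sup>2"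
    by (simp add: algebra_simps power2_eq_square)
  \<comment> \<open>The mixed product \<open>a * t\<close> is absorbed by the squares, and the
    coefficients are rounded up to the common value \<open>2 * K\<close>.\<close>
  also have "\<dots> \<le> 2 * K * (G * t) + 2 * K * (G * a) + K * (a\<^sup>2 + t\<^sup>2) + K * (a\<^sup>2 + t\<^sup>2)"
  proof -
    have "a * t \<le> a\<^sup>2 + t\<^sup>2"
      using sum_squares_bound[of a t] mult_nonneg_nonneg[OF a(2) t0] by linarith
    then have "K * (a * t) \<le> K * (a\<^sup>2 + t\<^sup>2)" using K by (rule mult_left_mono)
    moreover have "K * a\<^sup>2 \<le> K * (a\<^sup>2 + t\<^sup>2)" using K by (intro mult_left_mono) auto
    moreover have "0 \<le> K * (G * t)" using K G t0 by simp
    ultimately show ?thesis by linarith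
  qed
  finally show ?thesis by (simp add: a_def algebra_simps)
qed

text \<open>The clauses on integrability, differentiability and \<open>in_Lp\<close> certify that
  the integrals and \<open>fderiv\<close> values in the estimate are genuine and not default values.
  Independence of \<open>u\<theta>\<close> is expressed by the order of the quantifiers.\<close>

theorem proposition2p2:
  fixes \<mu> :: "'m::{real_inner,banach,second_countable_topology} measure"
    and Zad B :: "'z::euclidean_space set"
    and p :: real
    and u :: "'m \<times> 'z \<Rightarrow> 'u::{real_inner,banach,second_countable_topology}"
    and Q :: "'u \<times> 'm \<times> 'z \<Rightarrow> real"
  assumes "prob_space \<mu>" and "sets \<mu> = sets borel"
    and "compact Zad" and "open B" and "Zad \<subseteq> B"
    and "p \<ge> 2"
    and "assumption_A \<mu> Zad B p u"
    and "assumption_B Zad B Q"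
  shows "\<exists>C1 C2 :: real. \<forall>u\<theta> :: 'm \<times> 'z \<Rightarrow> 'u. assumption_A \<mu> Zad B p u\<theta> \<longrightarrow>
    (\<forall>z\<in>B. integrable \<mu> (\<lambda>m. Q (u (m, z), m, z)) \<and> integrable \<mu> (\<lambda>m. Q (u\<theta> (m, z), m, z))) \<and>
    (\<forall>z\<in>Zad.
       J_mean \<mu> Q u differentiable (at z) \<and>
       J_mean \<mu> Q u\<theta> differentiable (at z) \<and>
       in_Lp norm 2 \<mu> (\<lambda>m. u (m, z) - u\<theta> (m, z)) \<and>
       in_Lp hs_norm 2 \<mu> (\<lambda>m. Dz_state u m z - Dz_state u\<theta> m z) \<and>
       norm (fderiv (J_mean \<mu> Q u) z - fderiv (J_mean \<mu> Q u\<theta>) z)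
         \<le> C1 * (Lp_norm norm 2 \<mu> (\<lambda>m. u (m, z) - u\<theta> (m, z))
               + Lp_norm hs_norm 2 \<mu> (\<lambda>m. Dz_state u m z - Dz_state u\<theta> m z))
         + C2 * ((Lp_norm norm 2 \<mu> (\<lambda>m. u (m, z) - u\<theta> (m, z)))\<^sup>2
               + (Lp_norm hs_norm 2 \<mu> (\<lambda>m. Dz_state u m z - Dz_state u\<theta> m z))\<^sup>2))"
proof -
  note A = \<open>assumption_A \<mu> Zad B p u\<close> and AB = \<open>assumption_B Zad B Q\<close> and p = \<open>p \<ge> 2\<close>
    and ZB = \<open>Zad \<subseteq> B\<close> and sets = \<open>sets \<mu> = sets borel\<close>
  note meas_eq = measurable_cong_sets[OF sets refl]
  from A have mom: "integrable \<mu> (\<lambda>m. norm m powr p)" by (simp add: assumption_A_def)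
  note sq = integrable_second_moment[OF \<open>prob_space \<mu>\<close> sets p mom]
  have bZ: "bounded Zad" using \<open>compact Zad\<close> by (rule compact_imp_bounded)
  obtain K where K: "0 \<le> K"
    "\<And>w m z. z \<in> B \<Longrightarrow> norm (Du_Q Q w m z) \<le> K * (1 + norm w)"
    "\<And>w1 w2 m z. z \<in> B \<Longrightarrow> norm (Du_Q Q w2 m z - Du_Q Q w1 m z) \<le> K * norm (w2 - w1)"
    "\<And>w1 w2 m z. z \<in> B \<Longrightarrow>
      norm (Dz_Q Q w2 m z - Dz_Q Q w1 m z) \<le> K * (1 + norm w1 + norm (w2 - w1)) * norm (w2 - w1)"
    using assumption_B_growth[OF AB] by metis
  obtain R where R: "0 \<le> R"
    "\<And>m z. z \<in> Zad \<Longrightarrow> norm (u (m, z)) \<le> R * (1 + norm m)"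
    "\<And>m z. z \<in> Zad \<Longrightarrow> norm (Dz_state u m z) \<le> R * (1 + norm m)"
    using assumption_A_growth[OF A bZ ZB] by metis
  \<comment> \<open>One weight above both \<open>1 + norm (u (m, z))\<close> and the norm of
    \<open>Dz_state u m z\<close>, uniformly over \<open>Zad\<close>; it is built from
    \<open>R\<close>, hence from \<open>u\<close> alone.\<close>
  define G where "G m = (1 + R) * (1 + norm m)" for m :: 'm
  have G2: "integrable \<mu> (\<lambda>m. (G m)\<^sup>2)" using sq by (simp add: G_def power_mult_distrib)
  have Gm: "G \<in> borel_measurable \<mu>"
    unfolding meas_eq G_def by (intro borel_measurable_continuous_onI continuous_intros)
  have G: "1 + norm (u (m, z)) \<le> G m" "norm (Dz_state u m z) \<le> G m" if "z \<in> Zad" for m z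
    using R(2,3)[OF that, of m] norm_ge_zero[of m] by (simp_all add: G_def algebra_simps del: norm_ge_zero)
  \<comment> \<open>The factor \<open>2 * K\<close> comes from the pointwise bound and the
    \<open>L^2\<close> norm of \<open>G\<close> from Cauchy-Schwarz. The quadratic terms keep the
    bare factor, so \<open>C2\<close> is \<open>2 * K\<close>.\<close>
  define C1 where "C1 = 2 * K * sqrt (\<integral>m. (G m)\<^sup>2 \<partial>\<mu>)"
  show ?thesis
  proof (rule exI[of _ C1], rule exI[of _ "2 * K"], intro allI impI conjI ballI)
    fix v :: "'m \<times> 'z \<Rightarrow> 'u" and z assume Av: "assumption_A \<mu> Zad B p v"
    show "integrable \<mu> (\<lambda>m. Q (u (m, z), m, z))" "integrable \<mu> (\<lambda>m. Q (v (m, z), m, z))" if "z \<in> B"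
      using integrable_quantity_of_interest[OF A AB p that] integrable_quantity_of_interest[OF Av AB p that] .
    assume z: "z \<in> Zad"
    then have zB: "z \<in> B" using ZB by blast
    note du = J_mean_has_derivative[OF A AB p zB] and dv = J_mean_has_derivative[OF Av AB p zB]
    show diff: "J_mean \<mu> Q u differentiable (at z)" "J_mean \<mu> Q v differentiable (at z)"
      using du dv unfolding differentiable_def by blast+
    define a where "a m = norm (u (m, z) - v (m, z))" for m
    define t where "t m = hs_norm (Dz_state u m z - Dz_state v m z)" for m
    have a0: "0 \<le> a m" for m by (simp add: a_def)
    have t0: "0 \<le> t m" for m by (simp add: t_def hs_norm_def sum_nonneg)
    \<comment> \<open>\<open>R'\<close> depends on \<open>v\<close>; it serves to make the errors
      square integrable and never enters \<open>C1\<close> or \<open>C2\<close>.\<close>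
    obtain R' where R': "0 \<le> R'"
      "\<And>m. norm (v (m, z)) \<le> R' * (1 + norm m)" "\<And>m. norm (Dz_state v m z) \<le> R' * (1 + norm m)"
      using assumption_A_growth[OF Av bZ ZB] z by metis
    have cu: "continuous_on UNIV (\<lambda>m. u (m, z) - v (m, z))"
      and cT: "continuous_on UNIV (\<lambda>m. Dz_state u m z - Dz_state v m z)"
      by (intro continuous_intros assumption_A_continuous[OF A zB] assumption_A_continuous[OF Av zB])+
    have am: "a \<in> borel_measurable \<mu>"
      unfolding meas_eq a_def by (intro borel_measurable_continuous_onI continuous_intros cu)
    \<comment> \<open>\<open>hs_norm\<close> is built from finitely many evaluations at basis
      vectors, hence continuous for the operator-norm topology.\<close>
    have tm: "t \<in> borel_measurable \<mu>"
      unfolding meas_eq t_def hs_norm_def by (intro borel_measurable_continuous_onI continuous_intros cT)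
    define c where "c = (R + R')\<^sup>2"
    have dom: "integrable \<mu> (\<lambda>m. real DIM('z) * c * (1 + norm m)\<^sup>2)" "integrable \<mu> (\<lambda>m. c * (1 + norm m)\<^sup>2)"
      using sq by simp_all
    have a2: "integrable \<mu> (\<lambda>m. (a m)\<^sup>2)"
    proof (rule Bochner_Integration.integrable_bound[OF dom(2)])
      have "a m \<le> (R + R') * (1 + norm m)" for m
        using norm_triangle_ineq4[of "u (m, z)" "v (m, z)"] R(2)[OF z, of m] R'(2)[of m]
        unfolding a_def distrib_right by linarith
      then have "(a m)\<^sup>2 \<le> c * (1 + norm m)\<^sup>2" for m
        unfolding c_def power_mult_distrib[symmetric] by (rule power_mono[OF _ a0])
      then show "AE m in \<mu>. norm ((a m)\<^sup>2) \<le> norm (c * (1 + norm m)\<^sup>2)"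
        by (simp add: c_def)
    qed (use am in measurable)
    have t2: "integrable \<mu> (\<lambda>m. (t m)\<^sup>2)"
    proof (rule Bochner_Integration.integrable_bound[OF dom(1)])
      have "norm (Dz_state u m z - Dz_state v m z) \<le> (R + R') * (1 + norm m)" for m
        using norm_triangle_ineq4[of "Dz_state u m z" "Dz_state v m z"] R(3)[OF z, of m] R'(3)[of m]
        unfolding distrib_right by linarith
      then have "(norm (Dz_state u m z - Dz_state v m z))\<^sup>2 \<le> c * (1 + norm m)\<^sup>2" for m
        unfolding c_def power_mult_distrib[symmetric] by (rule power_mono[OF _ norm_ge_zero])
      then have "(t m)\<^sup>2 \<le> real DIM('z) * c * (1 + norm m)\<^sup>2" for m
        using hs_norm_power2_le[of "Dz_state u m z - Dz_state v m z"]
        unfolding t_def mult.assoc by (meson mult_left_mono of_nat_0_le_iff order_trans)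
      then show "AE m in \<mu>. norm ((t m)\<^sup>2) \<le> norm (real DIM('z) * c * (1 + norm m)\<^sup>2)"
        by (simp add: c_def)
    qed (use tm in measurable)
    have "(\<lambda>m. u (m, z) - v (m, z)) \<in> borel_measurable \<mu>"
      unfolding meas_eq using cu by (rule borel_measurable_continuous_onI)
    then show "in_Lp norm 2 \<mu> (\<lambda>m. u (m, z) - v (m, z))"
      using a2 by (simp add: in_Lp_def a_def)
    have "(\<lambda>m. Dz_state u m z - Dz_state v m z) \<in> borel_measurable \<mu>"
      unfolding meas_eq using cT by (rule borel_measurable_continuous_onI)
    then show "in_Lp hs_norm 2 \<mu> (\<lambda>m. Dz_state u m z - Dz_state v m z)"
      using t2 t0 by (simp add: in_Lp_def t_def)
    define La where "La = sqrt (\<integral>m. (a m)\<^sup>2 \<partial>\<mu>)"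
    define Lt where "Lt = sqrt (\<integral>m. (t m)\<^sup>2 \<partial>\<mu>)"
    have La: "Lp_norm norm 2 \<mu> (\<lambda>m. u (m, z) - v (m, z)) = La"
      by (simp add: Lp_norm_2_eq La_def a_def)
    have Lt: "Lp_norm hs_norm 2 \<mu> (\<lambda>m. Dz_state u m z - Dz_state v m z) = Lt"
      unfolding Lt_def t_def by (rule Lp_norm_2_eq) (simp add: hs_norm_def sum_nonneg)
    have sq_eq: "La\<^sup>2 = (\<integral>m. (a m)\<^sup>2 \<partial>\<mu>)" "Lt\<^sup>2 = (\<integral>m. (t m)\<^sup>2 \<partial>\<mu>)"
      by (simp_all add: La_def Lt_def)
    define E where "E m = 2 * K * (G m * a m + G m * t m) + 2 * K * ((a m)\<^sup>2 + (t m)\<^sup>2)" for m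
    note Ga = integrable_mult_L2[OF Gm am G2 a2] and Gt = integrable_mult_L2[OF Gm tm G2 t2]
    have intE: "integrable \<mu> E"
      unfolding E_def using Ga Gt a2 t2 by simp
    have "(\<integral>m. E m \<partial>\<mu>) = 2 * K * ((\<integral>m. G m * a m \<partial>\<mu>) + (\<integral>m. G m * t m \<partial>\<mu>)) + 2 * K * (La\<^sup>2 + Lt\<^sup>2)"
      unfolding E_def sq_eq using Ga Gt a2 t2 by simp
    \<comment> \<open>Cauchy-Schwarz is applied to the linear terms; the quadratic ones are already
      squared \<open>L^2\<close> norms.\<close>
    also have "\<dots> \<le> 2 * K * (sqrt (\<integral>m. (G m)\<^sup>2 \<partial>\<mu>) * La + sqrt (\<integral>m. (G m)\<^sup>2 \<partial>\<mu>) * Lt) + 2 * K * (La\<^sup>2 + Lt\<^sup>2)"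
      using K(1) Cauchy_Schwarz_integral[OF Gm am G2 a2] Cauchy_Schwarz_integral[OF Gm tm G2 t2]
      unfolding La_def Lt_def by (intro add_right_mono mult_left_mono add_mono) auto
    finally have E_le: "(\<integral>m. E m \<partial>\<mu>) \<le> C1 * (La + Lt) + 2 * K * (La\<^sup>2 + Lt\<^sup>2)"
      by (simp add: C1_def algebra_simps)
    have pointwise: "norm (reduced_gradient Q u m z - reduced_gradient Q v m z) \<le> E m" for m
      unfolding E_def a_def
      by (rule reduced_gradient_diff_le[OF K(1) K(2-4)[OF zB] refl G[OF z] refl])
        (simp add: t_def norm_le_hs_norm)
    \<comment> \<open>The derivatives are known through their action on a direction
      \<open>h\<close>, so the operator norm is estimated direction by direction.\<close>
    have "norm (fderiv (J_mean \<mu> Q u) z - fderiv (J_mean \<mu> Q v) z) \<le> (\<integral>m. E m \<partial>\<mu>)"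
    proof (rule norm_blinfun_bound)
      show "0 \<le> (\<integral>m. E m \<partial>\<mu>)"
        by (rule Bochner_Integration.integral_nonneg) (rule order_trans[OF norm_ge_zero pointwise])
      fix h
      note iu = integrable_reduced_gradient[OF A AB p zB, of h] and iv = integrable_reduced_gradient[OF Av AB p zB, of h]
      have "(fderiv (J_mean \<mu> Q u) z - fderiv (J_mean \<mu> Q v) z) h
          = (\<integral>m. reduced_gradient Q u m z h \<partial>\<mu>) - (\<integral>m. reduced_gradient Q v m z h \<partial>\<mu>)"
        using has_derivative_unique[OF fderiv_has_derivative[OF diff(1)] du]
          has_derivative_unique[OF fderiv_has_derivative[OF diff(2)] dv]
        by (simp add: blinfun.diff_left)
      also have "\<dots> = (\<integral>m. (reduced_gradient Q u m z - reduced_gradient Q v m z) h \<partial>\<mu>)"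
        using iu iv by (simp add: blinfun.diff_left)
      finally have "norm ((fderiv (J_mean \<mu> Q u) z - fderiv (J_mean \<mu> Q v) z) h)
          \<le> (\<integral>m. norm ((reduced_gradient Q u m z - reduced_gradient Q v m z) h) \<partial>\<mu>)"
        by (simp only: integral_norm_bound)
      also have "\<dots> \<le> (\<integral>m. E m * norm h \<partial>\<mu>)"
      proof (rule integral_mono)
        show "integrable \<mu> (\<lambda>m. norm ((reduced_gradient Q u m z - reduced_gradient Q v m z) h))"
          using iu iv by (simp add: blinfun.diff_left)
        show "norm ((reduced_gradient Q u m z - reduced_gradient Q v m z) h) \<le> E m * norm h" for m
          by (rule order_trans[OF norm_blinfun mult_right_mono[OF pointwise norm_ge_zero]])
      qed (use intE in simp)
      finally show "norm ((fderiv (J_mean \<mu> Q u) z - fderiv (J_mean \<mu> Q v) z) h) \<le> (\<integral>m. E m \<partial>\<mu>) * norm h"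
        by simp
    qed
    with E_le show "norm (fderiv (J_mean \<mu> Q u) z - fderiv (J_mean \<mu> Q v) z)
        \<le> C1 * (Lp_norm norm 2 \<mu> (\<lambda>m. u (m, z) - v (m, z))
              + Lp_norm hs_norm 2 \<mu> (\<lambda>m. Dz_state u m z - Dz_state v m z))
        + 2 * K * ((Lp_norm norm 2 \<mu> (\<lambda>m. u (m, z) - v (m, z)))\<^sup>2
              + (Lp_norm hs_norm 2 \<mu> (\<lambda>m. Dz_state u m z - Dz_state v m z))\<^sup>2)"
      unfolding La Lt by linarith
  qed
qed

end
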